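(* Suppose $\alpha<\beta=\delta$. Then the $p$-adic dynamical system generated by $f(x)=\frac{x^3+ax^2+bx}{ax+b}$ has the following properties. 1. (1.1) $SI(0)=U_\alpha(0)$. (1.2) If $\alpha<r<\beta$, then $S_r(0)$ is invariant for $f$. 2. If $r>\beta$ and $x\in S_r(0)$, then $\lim_{n\to\infty}|f^n(x)|_p=+\infty$. 3. Let $x\in S_\alpha(0)\setminus\mathcal{P}$ and $\hat\alpha(x)=|f(x)|_p$. (3.1) If $\hat\alpha(x)=\alpha$, then $f(x)\in S_\alpha(0)$. (3.2) If $\hat\alpha(x)<\beta$ and $\hat\alpha(x)\neq\alpha$, then $f^n(x)\in S_{\hat\alpha(x)}(0)$ for every $n\geq 1$. (3.3) If $\hat\alpha(x)=\beta$, then $f(x)\in S_\beta(0)$. (3.4) If $\hat\alpha(x)>\beta$, then $\lim_{n\to\infty}|f^n(x)|_p=+\infty$. 4. Let $x\in S_\beta(0)\setminus\mathcal{P}$ and $\hat\beta(x)=|f(x)|_p$. (4.1) If $\hat\beta(x)=\beta$, then $f(x)\in S_\beta(0)$. (4.2) If $\hat\beta(x)<\beta$ and $\hat\beta(x)\neq\alpha$, then $f^n(x)\in S_{\hat\beta(x)}(0)$ for every $n\geq 1$. (4.3) If $\hat\beta(x)=\alpha$, then $f(x)\in S_\alpha(0)$. 5. $\mathcal{P}\subset S_\alpha(0)\cup S_\beta(0)$.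
   Context: $p$ is a prime, $\mathbb{C}_p$ is the field of complex $p$-adic numbers with norm $|\cdot|_p$, and $a,b\in\mathbb{C}_p$ satisfy $ab\neq 0$. The function $f(x)=\frac{x^3+ax^2+bx}{ax+b}$ is defined for $x\in\mathbb{C}_p$, $x\neq\hat x:=-\frac{b}{a}$; its unique fixed point is $x_0=0$. Let $x_1,x_2=\frac{-a\pm\sqrt{a^2-4b}}{2}$ be the roots of $x^2+ax+b$ in $\mathbb{C}_p$ and put $\delta=|a|_p$, $\alpha=|x_1|_p$, $\beta=|x_2|_p$. $U_r(c)=\{x\in\mathbb{C}_p:|x-c|_p<r\}$, $S_r(c)=\{x\in\mathbb{C}_p:|x-c|_p=r\}$ (with $S_0(0)=\{0\}$). $\mathcal{P}=\{x\in\mathbb{C}_p:\exists n\in\mathbb{N}\cup\{0\},\ f^n(x)=\hat x\}$, where $f^n$ is the $n$-fold iterate. A sphere $S_\rho(0)$ is invariant for $f$ if $x\in S_\rho(0)$ implies that $f^n(x)$ is defined and lies in $S_\rho(0)$ for all $n\geq1$. The ball $U_r(0)$ is a Siegel disk if every sphere $S_\rho(0)$ with $\rho<r$ is invariant for $f$; $SI(0)$, the maximum Siegel disk, is the union of all Siegel disks centered at $0$. *)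

theory Defs
  imports Complex_Main "HOL-Computational_Algebra.Computational_Algebra"
begin

definition padic_abs :: "nat \<Rightarrow> rat \<Rightarrow> real" where
  "padic_abs p q =
     (if q = 0 then 0
      else real p powi (int (multiplicity (int p) (snd (quotient_of q)))
                        - int (multiplicity (int p) (fst (quotient_of q)))))"

text \<open>
  The topological closure of the image of \<open>rat\<close> for the absolute value \<open>v\<close>. In a complete
  field whose absolute value restricts to the \<open>p\<close>-adic one on \<open>rat\<close>, this is the field of
  \<open>p\<close>-adic numbers.
\<close>

definition rat_closure :: "('a::field_char_0 \<Rightarrow> real) \<Rightarrow> 'a set" where
  "rat_closure v = {x. \<forall>e>0. \<exists>q. v (x - of_rat q) < e}"

definition algebraic_over :: "'a::field set \<Rightarrow> 'a \<Rightarrow> bool" where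
  "algebraic_over F x \<longleftrightarrow> (\<exists>P. P \<noteq> 0 \<and> (\<forall>i. coeff P i \<in> F) \<and> poly P x = 0)"

text \<open>
  The library has no field of complex \<open>p\<close>-adic numbers. The locale describes it up to isometric
  isomorphism as the completion of an algebraic closure of the \<open>p\<close>-adic numbers: \<open>'a\<close> is
  complete for the ultrametric absolute value \<open>v\<close>, which extends the \<open>p\<close>-adic one, and the
  elements algebraic over the \<open>p\<close>-adic numbers are algebraically closed and dense in \<open>'a\<close>.
  (That \<open>'a\<close> itself is algebraically closed is a consequence.)
\<close>

locale complex_padic_field =
  fixes p :: nat and v :: "'a::field_char_0 \<Rightarrow> real"
  assumes prime_p: "prime p"
    and v_nonneg: "v x \<ge> 0"
    and v_eq_0_iff: "v x = 0 \<longleftrightarrow> x = 0"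
    and v_mult: "v (x * y) = v x * v y"
    and v_ultrametric: "v (x + y) \<le> max (v x) (v y)"
    and v_of_rat: "v (of_rat q) = padic_abs p q"
    and complete:
      "(\<forall>e>0. \<exists>N. \<forall>m\<ge>N. \<forall>n\<ge>N. v (X m - X n) < e) \<Longrightarrow>
         \<exists>L. (\<lambda>n. v (X n - L)) \<longlonglongrightarrow> 0"
    and algebraic_closed:
      "degree P > 0 \<Longrightarrow> (\<forall>i. algebraic_over (rat_closure v) (coeff P i)) \<Longrightarrow>
         \<exists>x. algebraic_over (rat_closure v) x \<and> poly P x = 0"
    and algebraic_dense:
      "e > 0 \<Longrightarrow> \<exists>y. algebraic_over (rat_closure v) y \<and> v (x - y) < e"

definition vball :: "('a::field \<Rightarrow> real) \<Rightarrow> 'a \<Rightarrow> real \<Rightarrow> 'a set" where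
  "vball v c r = {x. v (x - c) < r}"

definition vsphere :: "('a::field \<Rightarrow> real) \<Rightarrow> 'a \<Rightarrow> real \<Rightarrow> 'a set" where
  "vsphere v c r = {x. v (x - c) = r}"

definition f_map :: "'a::field \<Rightarrow> 'a \<Rightarrow> 'a \<Rightarrow> 'a" where
  "f_map a b x = (x^3 + a * x^2 + b * x) / (a * x + b)"

definition f_pole :: "'a::field \<Rightarrow> 'a \<Rightarrow> 'a" where
  "f_pole a b = - b / a"

text \<open>
  \<open>f_map a b\<close> is a total function, with the meaningless value \<open>0\<close> at the pole. The \<open>n\<close>-fold
  iterate is meaningful at \<open>x\<close> exactly if the orbit of \<open>x\<close> avoids the pole before step \<open>n\<close>.
\<close>

definition iter_defined :: "'a::field \<Rightarrow> 'a \<Rightarrow> nat \<Rightarrow> 'a \<Rightarrow> bool" where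
  "iter_defined a b n x \<longleftrightarrow> (\<forall>k<n. (f_map a b ^^ k) x \<noteq> f_pole a b)"

definition iter_in :: "'a::field \<Rightarrow> 'a \<Rightarrow> nat \<Rightarrow> 'a \<Rightarrow> 'a set \<Rightarrow> bool" where
  "iter_in a b n x A \<longleftrightarrow> iter_defined a b n x \<and> (f_map a b ^^ n) x \<in> A"

definition pole_preimages :: "'a::field \<Rightarrow> 'a \<Rightarrow> 'a set" where
  "pole_preimages a b = {x. \<exists>n. iter_in a b n x {f_pole a b}}"

definition iter_norm_to_infinity :: "('a::field \<Rightarrow> real) \<Rightarrow> 'a \<Rightarrow> 'a \<Rightarrow> 'a \<Rightarrow> bool" where
  "iter_norm_to_infinity v a b x \<longleftrightarrow>
     (\<forall>n. iter_defined a b n x) \<and>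
     filterlim (\<lambda>n. v ((f_map a b ^^ n) x)) at_top sequentially"

definition invariant_sphere :: "('a::field \<Rightarrow> real) \<Rightarrow> 'a \<Rightarrow> 'a \<Rightarrow> real \<Rightarrow> bool" where
  "invariant_sphere v a b \<rho> \<longleftrightarrow>
     (\<forall>x\<in>vsphere v 0 \<rho>. \<forall>n\<ge>1. iter_in a b n x (vsphere v 0 \<rho>))"

definition siegel_disk :: "('a::field \<Rightarrow> real) \<Rightarrow> 'a \<Rightarrow> 'a \<Rightarrow> real \<Rightarrow> bool" where
  "siegel_disk v a b r \<longleftrightarrow> r > 0 \<and> (\<forall>\<rho>. 0 \<le> \<rho> \<and> \<rho> < r \<longrightarrow> invariant_sphere v a b \<rho>)"

definition max_siegel_disk :: "('a::field \<Rightarrow> real) \<Rightarrow> 'a \<Rightarrow> 'a \<Rightarrow> 'a set" where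
  "max_siegel_disk v a b = \<Union> {vball v 0 r | r. siegel_disk v a b r}"

end

theory Submission
  imports Defs
begin

text \<open>
  Since \<open>x\<^sub>1 + x\<^sub>2 = -a\<close> and \<open>x\<^sub>1 x\<^sub>2 = b\<close>, the map factors as
  \<open>f x = x (x - x\<^sub>1) (x - x\<^sub>2) / (a (x - c))\<close> with the pole \<open>c = -b/a\<close> of absolute value \<open>\<alpha>\<close>.
  The ultrametric equality \<open>|x - y| = max |x| |y|\<close> for \<open>|x| \<noteq> |y|\<close> evaluates every factor
  as soon as \<open>|x|\<close> is neither \<open>\<alpha>\<close> nor \<open>\<beta>\<close>: with \<open>r = |x|\<close> we get \<open>|f x| = r\<close> for \<open>r < \<beta>\<close>
  and \<open>|f x| = r\<^sup>2/\<beta>\<close> for \<open>r > \<beta>\<close>. The maximal Siegel disk ends at \<open>\<alpha>\<close> because the pole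
  lies on \<open>S\<^sub>\<alpha>(0)\<close>.
\<close>

section \<open>Ultrametric absolute values\<close>

locale ultrametric_abs =
  fixes v :: "'a::field \<Rightarrow> real"
  assumes nonneg: "v x \<ge> 0"
    and eq_0_iff: "v x = 0 \<longleftrightarrow> x = 0"
    and mult: "v (x * y) = v x * v y"
    and ultrametric: "v (x + y) \<le> max (v x) (v y)"
begin

lemma one: "v 1 = 1"
  using mult[of 1 1] eq_0_iff[of 1] by simp

lemma minus: "v (- x) = v x"
proof -
  have "v (- 1) * v (- 1) = 1"
    using mult[of "- 1" "- 1"] one by simp
  then have "v (- 1) = 1"
    using nonneg[of "- 1"] by (metis abs_of_nonneg real_sqrt_abs2 real_sqrt_one)
  then show ?thesis
    using mult[of "- 1" x] by simp
qed

lemma divide: "v (x / y) = v x / v y"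
proof (cases "y = 0")
  case True
  then show ?thesis using eq_0_iff[of 0] by simp
next
  case False
  then show ?thesis
    using mult[of "x / y" y] eq_0_iff[of y] by (simp add: field_simps)
qed

lemma minus_commute: "v (x - y) = v (y - x)"
  using minus[of "x - y"] by simp

text \<open>Both bounds are ultrametric inequalities: one for \<open>x - y\<close>, the other for
  \<open>- y = (x - y) + (- x)\<close>, where \<open>v x < v y\<close> rules out \<open>v x\<close>
  as the maximum.\<close>

lemma diff_eq_right:
  assumes "v x < v y"
  shows "v (x - y) = v y"
  using ultrametric[of x "- y"] ultrametric[of "x - y" "- x"] minus[of x] minus[of y] assms
  by auto

lemma diff_eq_left:
  assumes "v y < v x"
  shows "v (x - y) = v x"
  using diff_eq_right[OF assms] minus_commute[of x y] by simp

end

section \<open>Orbits and the pole\<close>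

lemma iter_defined_Suc:
  "iter_defined a b (Suc n) x \<longleftrightarrow> x \<noteq> f_pole a b \<and> iter_defined a b n (f_map a b x)"
  unfolding iter_defined_def
  by (subst All_less_Suc2) (simp add: funpow_swap1[of "f_map a b"])

lemma iter_in_Suc:
  "iter_in a b (Suc n) x A \<longleftrightarrow> x \<noteq> f_pole a b \<and> iter_in a b n (f_map a b x) A"
  unfolding iter_in_def iter_defined_Suc by (simp add: funpow_swap1[of "f_map a b"])

lemma iter_in_invariant:
  assumes "x \<in> A" "\<And>y. y \<in> A \<Longrightarrow> f_map a b y \<in> A" "f_pole a b \<notin> A"
  shows "iter_in a b n x A"
  using assms(1)
proof (induction n arbitrary: x)
  case 0
  then show ?case by (simp add: iter_in_def iter_defined_def)
next
  case (Suc n)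
  then show ?case using assms(2,3) by (auto simp: iter_in_Suc)
qed

text \<open>Dropping the first term of an orbit does not affect its limit. This serves points that a
  single step throws into the escaping region.\<close>

lemma iter_norm_to_infinity_step:
  assumes "x \<noteq> f_pole a b" "iter_norm_to_infinity v a b (f_map a b x)"
  shows "iter_norm_to_infinity v a b x"
proof -
  have "iter_defined a b n x" for n
    using assms by (cases n) (auto simp: iter_norm_to_infinity_def iter_defined_Suc,
      simp add: iter_defined_def)
  moreover have "filterlim (\<lambda>n. v ((f_map a b ^^ Suc n) x)) at_top sequentially"
    using assms(2) by (simp add: iter_norm_to_infinity_def funpow_swap1[of "f_map a b"])
  ultimately show ?thesis
    using filterlim_sequentially_Suc[of "\<lambda>n. v ((f_map a b ^^ n) x)" at_top]
    by (simp add: iter_norm_to_infinity_def)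
qed

lemma pole_in_pole_preimages: "f_pole a b \<in> pole_preimages a b"
  unfolding pole_preimages_def iter_in_def iter_defined_def
  by (intro CollectI exI[of _ 0]) simp

lemma not_pole_preimageI:
  assumes "\<And>n. iter_defined a b n x"
  shows "x \<notin> pole_preimages a b"
proof
  assume "x \<in> pole_preimages a b"
  then obtain n where "(f_map a b ^^ n) x = f_pole a b"
    by (auto simp: pole_preimages_def iter_in_def)
  \<comment> \<open>\<open>iter_defined\<close> at \<open>n\<close> only inspects indices below
    \<open>n\<close>, so a visit to the pole at time \<open>n\<close> is first detected at
    \<open>Suc n\<close>.\<close>
  then show False using assms[of "Suc n"] by (auto simp: iter_defined_def)
qed

section \<open>The map with nonzero roots of different absolute values\<close>

locale separated_roots = ultrametric_abs v for v :: "'a::field \<Rightarrow> real" +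
  fixes a b x1 x2 :: 'a
  assumes sum_roots: "x1 + x2 = - a"
    and prod_roots: "x1 * x2 = b"
    and x1_nonzero: "x1 \<noteq> 0"
    and roots_less: "v x1 < v x2"
begin

lemma v_x1_pos: "0 < v x1"
  using nonneg[of x1] eq_0_iff[of x1] x1_nonzero by linarith

lemma v_x2_pos: "0 < v x2"
  using v_x1_pos roots_less by linarith

lemma a_eq: "a = - x1 - x2"
  using sum_roots by (metis diff_conv_add_uminus minus_add_distrib minus_minus)

lemma v_a: "v a = v x2"
  using diff_eq_right[of "- x1" x2] minus[of x1] roots_less by (simp add: a_eq)

lemma a_nonzero: "a \<noteq> 0"
  using v_a v_x2_pos eq_0_iff[of a] by auto

lemma v_pole: "v (f_pole a b) = v x1"
  using v_x2_pos prod_roots by (auto simp: f_pole_def divide minus mult v_a)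

text \<open>The factorization of \<open>f_map\<close> over its zeros and its pole. At the pole
  itself both sides are 0, since division by 0 yields 0.\<close>

lemma v_f_map:
  "v (f_map a b x) = v x * v (x - x1) * v (x - x2) / (v x2 * v (x - f_pole a b))"
proof -
  have "x^3 + a * x^2 + b * x = x * (x - x1) * (x - x2)"
    unfolding a_eq prod_roots[symmetric] by (simp add: algebra_simps power2_eq_square power3_eq_cube)
  moreover have "a * x + b = a * (x - f_pole a b)"
    using a_nonzero by (simp add: f_pole_def field_simps)
  ultimately show ?thesis
    by (simp add: f_map_def divide mult v_a)
qed

text \<open>The zero \<open>x1\<close> and the pole have equal absolute value, so off their sphere
  the factors \<open>x - x1\<close> and \<open>x - f_pole a b\<close> cancel in norm;
  \<open>x - x2\<close> cancels against the leading coefficient \<open>a\<close>.\<close>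

lemma v_f_map_preserved:
  assumes "v x < v x2" "v x \<noteq> v x1"
  shows "v (f_map a b x) = v x"
proof -
  have "v (x - x1) = v (x - f_pole a b)"
    using assms(2) diff_eq_left[of x1 x] diff_eq_right[of x x1]
      diff_eq_left[of "f_pole a b" x] diff_eq_right[of x "f_pole a b"] v_pole
    by (cases "v x < v x1") auto
  moreover have "v (x - f_pole a b) \<noteq> 0"
    using eq_0_iff assms(2) v_pole by auto
  ultimately show ?thesis
    using diff_eq_right[OF assms(1)] v_x2_pos by (simp add: v_f_map)
qed

lemma v_f_map_escaping:
  assumes "v x > v x2"
  shows "v (f_map a b x) = v x * v x / v x2"
  using diff_eq_left[OF assms] diff_eq_left[of x1 x] diff_eq_left[of "f_pole a b" x]
    assms roots_less v_pole v_x2_pos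
  by (simp add: v_f_map)

lemma iter_in_sphere:
  assumes "\<rho> < v x2" "\<rho> \<noteq> v x1" "v x = \<rho>"
  shows "iter_in a b n x (vsphere v 0 \<rho>)"
  using assms v_pole v_f_map_preserved
  by (intro iter_in_invariant) (auto simp: vsphere_def)

lemma invariant_sphere:
  assumes "\<rho> < v x2" "\<rho> \<noteq> v x1"
  shows "invariant_sphere v a b \<rho>"
  using iter_in_sphere[OF assms] by (auto simp: invariant_sphere_def vsphere_def)

text \<open>Beyond \<open>v x2\<close> a step multiplies the norm of \<open>y\<close> by
  \<open>v y / v x2\<close>. This ratio never drops below its initial value \<open>q > 1\<close>, so
  growth is at least geometric.\<close>

lemma iter_norm_to_infinity:
  assumes "v x > v x2"
  shows "iter_norm_to_infinity v a b x"
proof -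
  define q where "q = v x / v x2"
  have q: "q > 1" using assms v_x2_pos by (simp add: q_def)
  \<comment> \<open>The exponent \<open>Suc n\<close> makes the bound an equality at
    \<open>n = 0\<close>. In the induction step one factor \<open>v ?y\<close> is bounded by the
    hypothesis, and the quotient \<open>v ?y / v x2\<close> by \<open>q\<close>.\<close>
  have lower: "v x2 * q ^ Suc n \<le> v ((f_map a b ^^ n) x)" for n
  proof (induction n)
    case 0
    then show ?case using v_x2_pos by (simp add: q_def)
  next
    case (Suc n)
    let ?y = "(f_map a b ^^ n) x"
    have "q ^ 1 \<le> q ^ Suc n"
      using q by (intro power_increasing) auto
    then have "v x2 * q \<le> v x2 * q ^ Suc n" using v_x2_pos by simp
    then have y: "v x2 * q \<le> v ?y" using Suc by linarith
    have y': "v x2 < v ?y" using y assms v_x2_pos by (simp add: q_def)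
    have "q \<le> v ?y / v x2" using y v_x2_pos by (simp add: field_simps)
    then have "v x2 * q ^ Suc n * q \<le> v ?y * (v ?y / v x2)"
      using Suc nonneg q by (intro mult_mono) auto
    then show ?case using v_f_map_escaping[OF y'] by (simp add: mult_ac)
  qed
  have above: "v x2 < v ((f_map a b ^^ n) x)" for n
  proof -
    have "1 < q ^ Suc n" using q one_less_power by blast
    then have "v x2 * 1 < v x2 * q ^ Suc n" using v_x2_pos by (intro mult_strict_left_mono)
    then show ?thesis using lower[of n] by linarith
  qed
  have "iter_defined a b n x" for n
    using above v_pole roots_less unfolding iter_defined_def by (metis less_asym)
  moreover have "filterlim ((^) q) at_top sequentially"
    by (rule filterlim_at_infinity_imp_filterlim_at_top[OF filterlim_realpow_sequentially_gt1])
       (use q in auto)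
  then have "filterlim (\<lambda>n. v x2 * q ^ Suc n) at_top sequentially"
    using v_x2_pos
    by (intro filterlim_tendsto_pos_mult_at_top[OF tendsto_const]
          filterlim_sequentially_Suc[THEN iffD2])
  then have "filterlim (\<lambda>n. v ((f_map a b ^^ n) x)) at_top sequentially"
    by (rule filterlim_at_top_mono) (use lower in simp)
  ultimately show ?thesis
    by (simp add: iter_norm_to_infinity_def)
qed

text \<open>The pole lies on this sphere and has no defined image.\<close>

lemma not_invariant_sphere_inner: "\<not> invariant_sphere v a b (v x1)"
proof
  assume "invariant_sphere v a b (v x1)"
  then have "iter_in a b 1 (f_pole a b) (vsphere v 0 (v x1))"
    using v_pole by (simp add: invariant_sphere_def vsphere_def)
  then show False unfolding One_nat_def iter_in_Suc by simp
qed

text \<open>The radius \<open>v x1\<close> is attained because a Siegel disk constrains only spheres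
  of strictly smaller radius.\<close>

lemma siegel_disk_iff: "siegel_disk v a b r \<longleftrightarrow> 0 < r \<and> r \<le> v x1"
proof
  assume "siegel_disk v a b r"
  then show "0 < r \<and> r \<le> v x1"
    using not_invariant_sphere_inner nonneg[of x1] unfolding siegel_disk_def by (meson not_le)
next
  assume "0 < r \<and> r \<le> v x1"
  then show "siegel_disk v a b r"
    using invariant_sphere roots_less by (simp add: siegel_disk_def)
qed

lemma max_siegel_disk: "max_siegel_disk v a b = vball v 0 (v x1)"
proof
  show "max_siegel_disk v a b \<subseteq> vball v 0 (v x1)"
    by (auto simp: max_siegel_disk_def siegel_disk_iff vball_def)
  have "siegel_disk v a b (v x1)" using v_x1_pos by (simp add: siegel_disk_iff)
  then show "vball v 0 (v x1) \<subseteq> max_siegel_disk v a b"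
    unfolding max_siegel_disk_def by blast
qed

text \<open>After one step the orbit is on an invariant sphere, wherever it started; this covers the
  starting spheres of radius \<alpha> and \<beta> alike.\<close>

lemma iter_in_sphere_of_image:
  assumes "x \<noteq> f_pole a b" "v (f_map a b x) < v x2" "v (f_map a b x) \<noteq> v x1" "n \<ge> 1"
  shows "iter_in a b n x (vsphere v 0 (v (f_map a b x)))"
  using assms iter_in_sphere by (cases n) (auto simp: iter_in_Suc)

text \<open>On every other sphere the orbit either keeps its norm or escapes, and in both cases all
  iterates are defined.\<close>

lemma pole_preimages_subset: "pole_preimages a b \<subseteq> vsphere v 0 (v x1) \<union> vsphere v 0 (v x2)"
proof
  fix x assume x: "x \<in> pole_preimages a b"
  have "\<not> v x > v x2"
    using x iter_norm_to_infinity[of x] not_pole_preimageI[of a b x]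
    by (auto simp: iter_norm_to_infinity_def)
  moreover have "\<not> (v x < v x2 \<and> v x \<noteq> v x1)"
    using x iter_in_sphere[of "v x" x] not_pole_preimageI[of a b x] by (auto simp: iter_in_def)
  ultimately show "x \<in> vsphere v 0 (v x1) \<union> vsphere v 0 (v x2)"
    by (auto simp: vsphere_def)
qed

end

theorem theorem1:
  fixes p :: nat
    and v :: "'a::field_char_0 \<Rightarrow> real"
    and a b s x1 x2 :: 'a
    and \<alpha> \<beta> \<delta> :: real
  assumes Cp: "complex_padic_field p v"
    and ab: "a * b \<noteq> 0"
    and s: "s^2 = a^2 - 4 * b"
    and x1: "x1 = (- a + s) / 2"
    and x2: "x2 = (- a - s) / 2"
    and \<alpha>: "\<alpha> = v x1"
    and \<beta>: "\<beta> = v x2"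
    and \<delta>: "\<delta> = v a"
    and less: "\<alpha> < \<beta>"
    and eq: "\<beta> = \<delta>"
  shows
    "max_siegel_disk v a b = vball v 0 \<alpha>
     \<and> (\<forall>r. \<alpha> < r \<and> r < \<beta> \<longrightarrow> invariant_sphere v a b r)
     \<and> (\<forall>r x. r > \<beta> \<and> x \<in> vsphere v 0 r \<longrightarrow> iter_norm_to_infinity v a b x)
     \<and> (\<forall>x \<in> vsphere v 0 \<alpha> - pole_preimages a b.
           let \<alpha>' = v (f_map a b x) in
             (\<alpha>' = \<alpha> \<longrightarrow> f_map a b x \<in> vsphere v 0 \<alpha>)
           \<and> (\<alpha>' < \<beta> \<and> \<alpha>' \<noteq> \<alpha> \<longrightarrow> (\<forall>n\<ge>1. iter_in a b n x (vsphere v 0 \<alpha>')))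
           \<and> (\<alpha>' = \<beta> \<longrightarrow> f_map a b x \<in> vsphere v 0 \<beta>)
           \<and> (\<alpha>' > \<beta> \<longrightarrow> iter_norm_to_infinity v a b x))
     \<and> (\<forall>x \<in> vsphere v 0 \<beta> - pole_preimages a b.
           let \<beta>' = v (f_map a b x) in
             (\<beta>' = \<beta> \<longrightarrow> f_map a b x \<in> vsphere v 0 \<beta>)
           \<and> (\<beta>' < \<beta> \<and> \<beta>' \<noteq> \<alpha> \<longrightarrow> (\<forall>n\<ge>1. iter_in a b n x (vsphere v 0 \<beta>')))
           \<and> (\<beta>' = \<alpha> \<longrightarrow> f_map a b x \<in> vsphere v 0 \<alpha>))
     \<and> pole_preimages a b \<subseteq> vsphere v 0 \<alpha> \<union> vsphere v 0 \<beta>"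
proof -
  interpret complex_padic_field p v by (rule Cp)
  have "x1 + x2 = - a" unfolding x1 x2 by (simp add: field_simps)
  moreover have prod: "x1 * x2 = b"
  proof -
    have "4 * (x1 * x2) = a^2 - s^2"
      unfolding x1 x2 by (simp add: field_simps power2_eq_square)
    then show ?thesis using s by simp
  qed
  moreover have "x1 \<noteq> 0" using prod ab by auto
  ultimately interpret separated_roots v a b x1 x2
    using less \<alpha> \<beta> v_nonneg v_eq_0_iff v_mult v_ultrametric
    by unfold_locales auto
  have "\<forall>r. v x1 < r \<and> r < v x2 \<longrightarrow> invariant_sphere v a b r"
    using invariant_sphere by simp
  moreover have "\<forall>r x. r > v x2 \<and> x \<in> vsphere v 0 r \<longrightarrow> iter_norm_to_infinity v a b x"
    using iter_norm_to_infinity by (simp add: vsphere_def)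
  \<comment> \<open>The pole is its own preimage under zero steps, so outside
    \<open>pole_preimages\<close> the first image is meaningful.\<close>
  moreover have "x \<noteq> f_pole a b" if "x \<notin> pole_preimages a b" for x
    using that pole_in_pole_preimages by auto
  moreover have "iter_norm_to_infinity v a b x" if "x \<noteq> f_pole a b" "v x2 < v (f_map a b x)" for x
    using that iter_norm_to_infinity iter_norm_to_infinity_step by blast
  ultimately show ?thesis
    unfolding \<alpha> \<beta> Let_def
    using max_siegel_disk pole_preimages_subset iter_in_sphere_of_image
    by (simp add: vsphere_def)
qed

end
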